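(* Let $H=(V,\mathcal{E})$ be a hypergraph. The hitting-set coloring algorithm described in the context, run on $H$ (with any choice of minimal hitting sets in its iterations), produces a conflict-free coloring of $H$.
   Context: A hypergraph $H=(V,\mathcal{E})$ consists of a finite set $V$ and a family $\mathcal{E}$ of non-empty subsets of $V$. $\mathbb{N}$ is the set of non-negative integers and $\mathbb{Z}^+$ the set of positive integers. A function $C\colon V\to\mathbb{N}$ is a conflict-free coloring of $H$ if for every $S\in\mathcal{E}$ there is a color $i\in\mathbb{Z}^+$ with $|S\cap C^{-1}(i)|=1$. A hitting set of $H$ is a set $S\subseteq V$ that meets every $e\in\mathcal{E}$; it is minimal if for every $v\in S$, $S\setminus\{v\}$ is not a hitting set. Algorithm on input $H=(V,\mathcal{E})$: set $\ell=0$, $V^0=V$, $\mathcal{E}^0=\mathcal{E}$. While $\mathcal{E}^\ell\neq\emptyset$: let $S^\ell$ be a minimal hitting set of $(V^\ell,\mathcal{E}^\ell)$; color every $v\in V^\ell\setminus S^\ell$ with color $\ell$; set $V^{\ell+1}=S^\ell$ and $\mathcal{E}^{\ell+1}=\{e\cap S^\ell : e\in\mathcal{E}^\ell,\ |e\cap S^\ell|>1\}$; increase $\ell$ by one. When the loop ends, color every $v\in V^\ell$ (if any) with color $\ell$. *)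

theory Defs imports Main begin

definition hypergraph :: "'a set \<Rightarrow> 'a set set \<Rightarrow> bool" where
  "hypergraph V E \<longleftrightarrow> finite V \<and> (\<forall>e\<in>E. e \<noteq> {} \<and> e \<subseteq> V)"

(* A coloring V -> N is a map with domain exactly V. Color 0 does not count
   as a witness for conflict-freeness. *)
definition conflict_free_coloring :: "'a set \<Rightarrow> 'a set set \<Rightarrow> ('a \<rightharpoonup> nat) \<Rightarrow> bool" where
  "conflict_free_coloring V E C \<longleftrightarrow>
     dom C = V \<and> (\<forall>S\<in>E. \<exists>i::nat. i > 0 \<and> card (S \<inter> C -` {Some i}) = 1)"

definition hitting_set :: "'a set \<Rightarrow> 'a set set \<Rightarrow> 'a set \<Rightarrow> bool" where
  "hitting_set V E S \<longleftrightarrow> S \<subseteq> V \<and> (\<forall>e\<in>E. S \<inter> e \<noteq> {})"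

definition minimal_hitting_set :: "'a set \<Rightarrow> 'a set set \<Rightarrow> 'a set \<Rightarrow> bool" where
  "minimal_hitting_set V E S \<longleftrightarrow>
     hitting_set V E S \<and> (\<forall>v\<in>S. \<not> hitting_set V E (S - {v}))"

(* The hitting-set coloring algorithm as a transition system. The field
   "coloring" is the partial coloring assigned so far. *)
record 'a hs_state =
  level :: nat
  verts :: "'a set"
  edges :: "'a set set"
  coloring :: "'a \<rightharpoonup> nat"

definition hs_init :: "'a set \<Rightarrow> 'a set set \<Rightarrow> 'a hs_state" where
  "hs_init V E = \<lparr>level = 0, verts = V, edges = E, coloring = Map.empty\<rparr>"

(* One iteration of the while loop. It is nondeterministic: any minimal hitting
   set of the current hypergraph may be picked. *)
inductive hs_step :: "'a hs_state \<Rightarrow> 'a hs_state \<Rightarrow> bool" where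
  "hs_step s
     \<lparr>level = level s + 1,
      verts = S,
      edges = {e \<inter> S | e. e \<in> edges s \<and> card (e \<inter> S) > 1},
      coloring = (\<lambda>v. if v \<in> verts s - S then Some (level s) else coloring s v)\<rparr>"
  if "edges s \<noteq> {}" and "minimal_hitting_set (verts s) (edges s) S"

(* The coloring returned when the loop has ended in state s. *)
definition hs_final_coloring :: "'a hs_state \<Rightarrow> ('a \<rightharpoonup> nat)" where
  "hs_final_coloring s = (\<lambda>v. if v \<in> verts s then Some (level s) else coloring s v)"

definition hs_output :: "'a set \<Rightarrow> 'a set set \<Rightarrow> ('a \<rightharpoonup> nat) \<Rightarrow> bool" where
  "hs_output V E C \<longleftrightarrow>
     (\<exists>s. hs_step\<^sup>*\<^sup>* (hs_init V E) s \<and> edges s = {} \<and> C = hs_final_coloring s)"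

end

theory Submission imports Defs begin

text \<open>
  Termination: every vertex of a minimal hitting set \<open>S\<close> has a private edge, one that meets
  \<open>S\<close> in that vertex only (\<open>minimal_hitting_set_private_edge\<close>). Such an edge shrinks to a single
  vertex and is discarded, so each iteration strictly decreases the number of edges. The number
  of vertices would not do as a measure: if every vertex forms an edge by itself, then the first
  hitting set is the whole vertex set.

  The loop never gets stuck, because the vertex set of a finite hypergraph is a hitting set and
  hence contains a minimal one.

  Conflict-freeness: an edge \<open>e\<close> leaves the process at the first level \<open>l\<close> where only one of its
  vertices, say \<open>v\<close>, is in the chosen hitting set; it cannot lose all of them, since a hitting
  set meets it. From then on every other vertex of \<open>e\<close> has a color at most \<open>l\<close>, while \<open>v\<close>
  survives and receives some color at least \<open>l + 1\<close>. This color is positive and unique in \<open>e\<close>.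
  The loop invariant \<open>hs_invariant\<close> follows an edge through these phases.
\<close>

text \<open>If \<open>v\<close> had no private edge, then \<open>S - {v}\<close> would still be a hitting set.\<close>

lemma minimal_hitting_set_private_edge:
  assumes "minimal_hitting_set V E S" and "v \<in> S"
  obtains e where "e \<in> E" and "e \<inter> S = {v}"
proof -
  have hit: "S \<subseteq> V" "\<forall>e\<in>E. S \<inter> e \<noteq> {}" and "\<not> hitting_set V E (S - {v})"
    using assms by (auto simp: minimal_hitting_set_def hitting_set_def)
  then obtain e where "e \<in> E" "(S - {v}) \<inter> e = {}"
    unfolding hitting_set_def by blast
  moreover from this hit have "e \<inter> S = {v}" by blast
  ultimately show thesis using that by blast
qed

lemma minimal_hitting_set_exists:
  assumes "hypergraph V E"
  shows "\<exists>S. minimal_hitting_set V E S"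
proof -
  let ?H = "{S. hitting_set V E S}"
  have "finite V" "hitting_set V E V"
    using assms by (auto simp: hypergraph_def hitting_set_def)
  moreover have "?H \<subseteq> Pow V" by (auto simp: hitting_set_def)
  ultimately have "finite ?H" "?H \<noteq> {}"
    by (auto intro: finite_subset)
  then obtain S where "S \<in> ?H" "\<forall>T\<in>?H. T \<subseteq> S \<longrightarrow> S = T"
    using finite_has_minimal[of ?H] by auto
  then have "minimal_hitting_set V E S"
    unfolding minimal_hitting_set_def by blast
  then show ?thesis ..
qed

lemma hypergraph_finite_edges: "hypergraph V E \<Longrightarrow> finite E"
  by (auto simp: hypergraph_def intro: finite_subset[of E "Pow V"])

lemma hs_step_hypergraph:
  assumes "hs_step s t" and "hypergraph (verts s) (edges s)"
  shows "hypergraph (verts t) (edges t)"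
  using assms(1)
proof cases
  case (1 S)
  then have "S \<subseteq> verts s" by (auto simp: minimal_hitting_set_def hitting_set_def)
  with 1 assms(2) show ?thesis
    by (auto simp: hypergraph_def intro: finite_subset)
qed

lemma hs_step_card_edges_less:
  assumes "hs_step s t" and "hypergraph (verts s) (edges s)"
  shows "card (edges t) < card (edges s)"
  using assms(1)
proof cases
  case (1 S)
  let ?K = "{e \<in> edges s. card (e \<inter> S) > 1}"
  \<comment> \<open>\<open>S\<close> is non-empty because there is an edge to hit; any of its vertices has a private edge.\<close>
  from 1 have "\<forall>e\<in>edges s. S \<inter> e \<noteq> {}"
    by (simp add: minimal_hitting_set_def hitting_set_def)
  with \<open>edges s \<noteq> {}\<close> obtain v where "v \<in> S" by blast
  with 1 obtain e where "e \<in> edges s" "e \<inter> S = {v}"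
    using minimal_hitting_set_private_edge by metis
  then have "e \<in> edges s - ?K" by simp
  then have "?K \<subset> edges s" by blast
  moreover have fin: "finite (edges s)" using assms(2) by (rule hypergraph_finite_edges)
  ultimately have "card ?K < card (edges s)" by (simp add: psubset_card_mono)
  moreover have "edges t = (\<lambda>e. e \<inter> S) ` ?K" using 1 by auto
  moreover have "card ((\<lambda>e. e \<inter> S) ` ?K) \<le> card ?K" using fin by (simp add: card_image_le)
  ultimately show ?thesis by simp
qed

lemma hs_no_infinite_run:
  assumes "hypergraph (verts (r 0)) (edges (r 0))" and step: "\<And>n. hs_step (r n) (r (Suc n))"
  shows False
proof -
  have "hypergraph (verts (r n)) (edges (r n))" for n
    by (induction n) (use assms hs_step_hypergraph in blast)+
  then have "card (edges (r (Suc n))) < card (edges (r n))" for n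
    using hs_step_card_edges_less step by blast
  then show False
    using wf_iff_no_infinite_down_chain[of "measure (\<lambda>s. card (edges s))"] by auto
qed

text \<open>
  Both the loop body and the final statement give the new color \<open>level s\<close> to a set of vertices
  that are still alive. As all earlier colors are smaller and belong to dead vertices, this does
  not disturb the earlier color classes.
\<close>

lemma color_class_extend:
  fixes C :: "'a \<rightharpoonup> nat"
  assumes "dom C \<inter> A = {}" and "\<And>v i. C v = Some i \<Longrightarrow> i < l"
  shows "(\<lambda>v. if v \<in> A then Some l else C v) -` {Some l} = A"
    and "i < l \<Longrightarrow> (\<lambda>v. if v \<in> A then Some l else C v) -` {Some i} = C -` {Some i}"
proof -
  show "(\<lambda>v. if v \<in> A then Some l else C v) -` {Some l} = A"
    using assms(2)[of _ l] by (auto split: if_splits)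
  show "(\<lambda>v. if v \<in> A then Some l else C v) -` {Some i} = C -` {Some i}" if "i < l"
    using assms(1) that by (auto split: if_splits)
qed

text \<open>
  The last conjunct lists the phases of an original edge \<open>e\<close>: it is still being processed; or it
  has been discarded and its last live vertex awaits a color, where \<open>0 < level s\<close> makes that
  color admissible; or it already has its uniquely colored vertex.
\<close>

definition hs_invariant :: "'a set \<Rightarrow> 'a set set \<Rightarrow> 'a hs_state \<Rightarrow> bool" where
  "hs_invariant V E s \<longleftrightarrow>
     hypergraph (verts s) (edges s) \<and> verts s \<subseteq> V \<and> dom (coloring s) = V - verts s \<and>
     (\<forall>v i. coloring s v = Some i \<longrightarrow> i < level s) \<and>
     (\<forall>e\<in>E. e \<inter> verts s \<in> edges s \<or>
        0 < level s \<and> card (e \<inter> verts s) = 1 \<or>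
        (\<exists>i. 0 < i \<and> i < level s \<and> card (e \<inter> coloring s -` {Some i}) = 1))"

lemma hs_invariant_init:
  assumes "hypergraph V E"
  shows "hs_invariant V E (hs_init V E)"
proof -
  have "e \<inter> V = e" if "e \<in> E" for e using assms that by (auto simp: hypergraph_def)
  with assms show ?thesis by (simp add: hs_invariant_def hs_init_def)
qed

lemma hs_invariant_step:
  assumes inv: "hs_invariant V E s" and step: "hs_step s t"
  shows "hs_invariant V E t"
  using step
proof cases
  case (1 S)
  let ?W = "verts s" and ?l = "level s"
  have S: "S \<subseteq> ?W" and hits: "\<And>e. e \<in> edges s \<Longrightarrow> e \<inter> S \<noteq> {}"
    using 1 by (auto simp: minimal_hitting_set_def hitting_set_def)
  have hyp: "hypergraph ?W (edges s)" and W: "?W \<subseteq> V" and dom: "dom (coloring s) = V - ?W"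
    and bound: "\<And>v i. coloring s v = Some i \<Longrightarrow> i < ?l"
    and phases: "\<And>e. e \<in> E \<Longrightarrow> e \<inter> ?W \<in> edges s \<or> 0 < ?l \<and> card (e \<inter> ?W) = 1 \<or>
      (\<exists>i. 0 < i \<and> i < ?l \<and> card (e \<inter> coloring s -` {Some i}) = 1)"
    using inv by (simp_all add: hs_invariant_def)
  have "finite S" using hyp S by (auto simp: hypergraph_def intro: finite_subset)
  have col: "coloring t = (\<lambda>v. if v \<in> ?W - S then Some ?l else coloring s v)"
    and [simp]: "level t = Suc ?l" "verts t = S"
    and edges_t: "edges t = {e \<inter> S | e. e \<in> edges s \<and> card (e \<inter> S) > 1}"
    using 1 by auto
  have "dom (coloring s) \<inter> (?W - S) = {}" using dom by blast
  note classes = color_class_extend[OF this bound, folded col]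
  have "e \<inter> S \<in> edges t \<or> card (e \<inter> S) = 1 \<or>
      (\<exists>i. 0 < i \<and> i < Suc ?l \<and> card (e \<inter> coloring t -` {Some i}) = 1)"
    if "e \<in> E" for e
  proof -
    consider (active) "e \<inter> ?W \<in> edges s"
      | (waiting) "0 < ?l" "card (e \<inter> ?W) = 1"
      | (settled) i where "0 < i" "i < ?l" "card (e \<inter> coloring s -` {Some i}) = 1"
      using phases[OF \<open>e \<in> E\<close>] by iprover
    then show ?thesis
    proof cases
      case active
      have eq: "e \<inter> ?W \<inter> S = e \<inter> S" using S by blast
      then have "e \<inter> S \<noteq> {}" using hits[OF active] by simp
      with \<open>finite S\<close> have "card (e \<inter> S) > 0" by (simp add: card_gt_0_iff)
      moreover have "e \<inter> S \<in> edges t" if "card (e \<inter> S) > 1"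
        unfolding edges_t using active eq that by (metis (mono_tags, lifting) mem_Collect_eq)
      ultimately show ?thesis by linarith
    next
      case waiting
      then obtain v where v: "e \<inter> ?W = {v}" by (auto simp: card_1_singleton_iff)
      show ?thesis
      proof (cases "v \<in> S")
        case True
        with v S have "e \<inter> S = {v}" by blast
        then show ?thesis by simp
      next
        case False
        \<comment> \<open>The vertex \<open>v\<close> dies now and is the only vertex of \<open>e\<close> with the new color.\<close>
        with v S have "e \<inter> (?W - S) = {v}" by blast
        with classes(1) have "card (e \<inter> coloring t -` {Some ?l}) = 1" by simp
        with waiting show ?thesis by blast
      qed
    next
      case settled
      with classes(2) have "card (e \<inter> coloring t -` {Some i}) = 1" by simp
      with settled show ?thesis using less_SucI by blast
    qed
  qed
  moreover have "dom (coloring t) = V - S"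
    using dom W S by (auto simp: col dom_def split: if_splits)
  moreover have "\<forall>v i. coloring t v = Some i \<longrightarrow> i < Suc ?l"
    using bound by (auto simp: col less_SucI)
  moreover have "hypergraph S (edges t)" using hs_step_hypergraph[OF step hyp] by simp
  ultimately show ?thesis using S W by (simp add: hs_invariant_def subset_trans)
qed

lemma hs_invariant_reachable:
  assumes "hypergraph V E" and "hs_step\<^sup>*\<^sup>* (hs_init V E) s"
  shows "hs_invariant V E s"
  using assms(2)
  by (induction rule: rtranclp_induct) (use assms(1) hs_invariant_init hs_invariant_step in blast)+

lemma hs_invariant_final:
  assumes inv: "hs_invariant V E s" and "edges s = {}"
  shows "conflict_free_coloring V E (hs_final_coloring s)"
proof -
  let ?C = "hs_final_coloring s"
  have W: "verts s \<subseteq> V" and dom: "dom (coloring s) = V - verts s"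
    and bound: "\<And>v i. coloring s v = Some i \<Longrightarrow> i < level s"
    and phases: "\<And>e. e \<in> E \<Longrightarrow> 0 < level s \<and> card (e \<inter> verts s) = 1 \<or>
      (\<exists>i. 0 < i \<and> i < level s \<and> card (e \<inter> coloring s -` {Some i}) = 1)"
    using inv assms(2) by (simp_all add: hs_invariant_def)
  have "dom (coloring s) \<inter> verts s = {}" using dom by blast
  note classes = color_class_extend[OF this bound, folded hs_final_coloring_def]
  have "\<exists>i>0. card (e \<inter> ?C -` {Some i}) = 1" if "e \<in> E" for e
  proof -
    consider "0 < level s" "card (e \<inter> verts s) = 1"
      | i where "0 < i" "i < level s" "card (e \<inter> coloring s -` {Some i}) = 1"
      using phases[OF \<open>e \<in> E\<close>] by iprover
    then show ?thesis
    proof cases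
      case 1
      with classes(1) have "card (e \<inter> ?C -` {Some (level s)}) = 1" by simp
      with 1 show ?thesis by blast
    next
      case 2
      with classes(2) have "card (e \<inter> ?C -` {Some i}) = 1" by simp
      with 2 show ?thesis by blast
    qed
  qed
  moreover have "dom ?C = V"
    using W dom by (auto simp: hs_final_coloring_def dom_def split: if_splits)
  ultimately show ?thesis by (simp add: conflict_free_coloring_def)
qed

theorem lemma2p5:
  fixes V :: "'a set" and E :: "'a set set"
  assumes "hypergraph V E"
  shows "(\<nexists>r :: nat \<Rightarrow> 'a hs_state. r 0 = hs_init V E \<and> (\<forall>n. hs_step (r n) (r (Suc n))))
    \<and> (\<forall>s. hs_step\<^sup>*\<^sup>* (hs_init V E) s \<and> edges s \<noteq> {} \<longrightarrow> (\<exists>s'. hs_step s s'))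
    \<and> (\<forall>C. hs_output V E C \<longrightarrow> conflict_free_coloring V E C)"
proof (intro conjI)
  show "\<nexists>r :: nat \<Rightarrow> 'a hs_state. r 0 = hs_init V E \<and> (\<forall>n. hs_step (r n) (r (Suc n)))"
  proof
    assume "\<exists>r :: nat \<Rightarrow> 'a hs_state. r 0 = hs_init V E \<and> (\<forall>n. hs_step (r n) (r (Suc n)))"
    then obtain r :: "nat \<Rightarrow> 'a hs_state"
      where "r 0 = hs_init V E" "\<And>n. hs_step (r n) (r (Suc n))" by blast
    with assms show False using hs_no_infinite_run[of r] by (simp add: hs_init_def)
  qed
  show "\<forall>s. hs_step\<^sup>*\<^sup>* (hs_init V E) s \<and> edges s \<noteq> {} \<longrightarrow> (\<exists>s'. hs_step s s')"
  proof (intro allI impI, elim conjE)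
    fix s assume "hs_step\<^sup>*\<^sup>* (hs_init V E) s" and ne: "edges s \<noteq> {}"
    with assms have "hypergraph (verts s) (edges s)"
      using hs_invariant_reachable hs_invariant_def by blast
    then obtain S where "minimal_hitting_set (verts s) (edges s) S"
      using minimal_hitting_set_exists by blast
    with ne show "\<exists>s'. hs_step s s'" by (blast intro: hs_step.intros)
  qed
  show "\<forall>C. hs_output V E C \<longrightarrow> conflict_free_coloring V E C"
    using hs_invariant_reachable[OF assms] hs_invariant_final by (auto simp: hs_output_def)
qed

end
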